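(* The $\theta$-routing algorithm is not $o(n)$-competitive on the $\theta_5$-graph. That is, there is no function $f:\mathbb{N}\to\mathbb{R}_{>0}$ with $f(n)/n\to 0$ as $n\to\infty$ such that, for every $n\ge 2$ and every set $P$ of $n$ points in the plane (in general position with respect to the cone directions), the $\theta$-routing algorithm is $f(n)$-competitive on the $\theta_5$-graph of $P$.
   Context: Let $\theta = 2\pi/5$. For a point $u$ in the plane, the five rays from $u$ whose directions make angles that are consecutive multiples of $\theta$ with the negative $y$-axis divide the plane into five cones with apex $u$, labelled $C_0^u, C_1^u, C_2^u, C_3^u, C_4^u$ in clockwise order starting from the top one; thus the bisector of $C_i^u$ is the ray from $u$ whose direction is the positive $y$-direction rotated clockwise by $i\theta$. General position: no two distinct points of $P$ lie on a line parallel or perpendicular to a cone boundary. (Hence each point of $P\setminus\{u\}$ lies in the interior of exactly one cone of $u$, and no two points of $P$ in a cone have the same projection on its bisector.) For a finite point set $P$, the point of $P\setminus\{u\}$ in cone $C_i^u$ that is closest to $u$ is the one whose orthogonal projection onto the bisector of $C_i^u$ is closest to $u$. The $\theta_5$-graph of $P$ is the undirected graph with vertex set $P$ in which, for every $u\in P$ and every $i\in\{0,\dots,4\}$ such that $C_i^u$ contains a point of $P\setminus\{u\}$, there is an edge between $u$ and the closest point to $u$ in $C_i^u$. The length of an edge is the Euclidean distance between its endpoints; $|uw|$ denotes Euclidean distance; the length of a path is the sum of the lengths of its edges. The $\theta$-routing algorithm: given a source and a destination $w$ in $P$, from the current vertex $v\ne w$ move along the edge to the closest vertex to $v$ in the cone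 of $v$ that contains $w$ (equivalently, the closest vertex in the triangle cut off from that cone by the line through $w$ perpendicular to the cone's bisector); repeat this step until $w$ is reached. A routing algorithm is $c$-competitive on a graph $G$ with vertex set $P$ if for each pair of vertices $u,w$ (source $u$, destination $w$) the algorithm finds a path from $u$ to $w$ of length at most $c\cdot|uw|$. *)

theory Defs
  imports "HOL-Analysis.Analysis"
begin

text \<open>The plane is \<^typ>\<open>complex\<close>, with its Euclidean distance and inner product;
  multiplication by \<^term>\<open>cis (- a)\<close> is the clockwise rotation by \<open>a\<close>.\<close>

definition \<theta> :: real where
  "\<theta> = 2 * pi / 5"

definition boundary_dir :: "nat \<Rightarrow> complex" where
  "boundary_dir k = - \<i> * cis (- (real k * \<theta>))"

definition bisector_dir :: "nat \<Rightarrow> complex" where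
  "bisector_dir i = \<i> * cis (- (real i * \<theta>))"

text \<open>The boundary rays are numbered clockwise from the negative y-axis, the cones clockwise from
  the top one. The top cone lies between the rays obtained from the negative y-axis by clockwise
  rotations through \<open>2\<theta>\<close> (144 degrees) and \<open>3\<theta>\<close> (216 degrees), hence the index shift. Cones are
  closed; in general position no point of \<open>P\<close> lies on a boundary ray of another one.\<close>

definition theta_cone :: "complex \<Rightarrow> nat \<Rightarrow> complex set" where
  "theta_cone u i =
     {u + a *\<^sub>R boundary_dir (i + 2) + b *\<^sub>R boundary_dir (i + 3) | a b. 0 \<le> a \<and> 0 \<le> b}"

definition general_position :: "complex set \<Rightarrow> bool" where
  "general_position P \<longleftrightarrow>
     (\<forall>p\<in>P. \<forall>q\<in>P. p \<noteq> q \<longrightarrow>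
        (\<forall>k<5. q - p \<notin> span {boundary_dir k} \<and> \<not> orthogonal (q - p) (boundary_dir k)))"

definition bisector_proj :: "complex \<Rightarrow> nat \<Rightarrow> complex \<Rightarrow> complex" where
  "bisector_proj u i x = u + ((x - u) \<bullet> bisector_dir i) *\<^sub>R bisector_dir i"

definition closest_in_cone :: "complex set \<Rightarrow> complex \<Rightarrow> nat \<Rightarrow> complex \<Rightarrow> bool" where
  "closest_in_cone P u i x \<longleftrightarrow>
     x \<in> (P - {u}) \<inter> theta_cone u i \<and>
     (\<forall>y \<in> (P - {u}) \<inter> theta_cone u i.
        dist u (bisector_proj u i x) \<le> dist u (bisector_proj u i y))"

text \<open>An undirected graph is a pair of a vertex set and a set of two-element edges.\<close>

type_synonym 'a ugraph = "'a set \<times> 'a set set"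

definition theta5_graph :: "complex set \<Rightarrow> complex ugraph" where
  "theta5_graph P = (P, {{u, x} | u x. u \<in> P \<and> (\<exists>i<5. closest_in_cone P u i x)})"

definition is_path :: "'a ugraph \<Rightarrow> 'a list \<Rightarrow> bool" where
  "is_path G p \<longleftrightarrow> p \<noteq> [] \<and> set p \<subseteq> fst G \<and>
     (\<forall>k. Suc k < length p \<longrightarrow> {p ! k, p ! Suc k} \<in> snd G)"

definition path_len :: "'a::metric_space list \<Rightarrow> real" where
  "path_len p = (\<Sum>k<length p - 1. dist (p ! k) (p ! Suc k))"

text \<open>A (memoryless) routing algorithm maps the destination and the current vertex to the next
  vertex. It finds \<open>p\<close> if \<open>p\<close> is the sequence of vertices visited from the source \<open>u\<close> until the
  first visit to the destination \<open>w\<close>.\<close>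

type_synonym 'a routing = "'a \<Rightarrow> 'a \<Rightarrow> 'a"

definition finds :: "'a routing \<Rightarrow> 'a \<Rightarrow> 'a \<Rightarrow> 'a list \<Rightarrow> bool" where
  "finds A u w p \<longleftrightarrow> p \<noteq> [] \<and> hd p = u \<and> last p = w \<and> w \<notin> set (butlast p) \<and>
     (\<forall>k. Suc k < length p \<longrightarrow> p ! Suc k = A w (p ! k))"

definition competitive :: "real \<Rightarrow> 'a::metric_space ugraph \<Rightarrow> 'a routing \<Rightarrow> bool" where
  "competitive c G A \<longleftrightarrow>
     (\<forall>u \<in> fst G. \<forall>w \<in> fst G. \<exists>p. finds A u w p \<and> is_path G p \<and> path_len p \<le> c * dist u w)"

text \<open>For finite \<open>P\<close> in general position and distinct \<open>v\<close>, \<open>w\<close> in \<open>P\<close> there is exactly one such \<open>x\<close>: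
  only one cone of \<open>v\<close> contains \<open>w\<close>, and its closest point is unique.\<close>

definition theta_routing :: "complex set \<Rightarrow> complex routing" where
  "theta_routing P w v = (THE x. \<exists>i<5. w \<in> theta_cone v i \<and> closest_in_cone P v i x)"

end

theory Submission
  imports Defs
begin

text \<open>Put the destination \<open>w\<close> at the origin and let \<open>R\<close> be the clockwise rotation by \<open>\<theta>\<close>. Consider the
  point \<open>A\<close> for which \<open>R A\<close> is the far corner of the triangle of \<open>A\<close> and \<open>w\<close>. Greedy routing can then
  almost be forced to run forever around the regular pentagon \<open>A, R A, R\<^sup>2 A, \<dots>\<close>, provided that every
  visited point lies slightly inside the triangle of its predecessor. Later visits near the same
  corner come closer to \<open>w\<close>, so an earlier visitor would be short-cut to a later one. This is avoided
  by two points per corner: an arrival point, and a departure point reached by a short slide along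
  the cone boundary, from which all later visitors of the corner lie outside the cone. With
  deviations from the pentagon that shrink geometrically all constraints hold, also general
  position. So \<open>2 m\<close> points force about \<open>m\<close> jumps of constant length at constant distance from \<open>w\<close>.

  Everything is expressed by the signed distances from the five boundary directions; three
  consecutive ones satisfy a linear recurrence with coefficient \<open>2 cos \<theta>\<close>, the inverse golden ratio,
  which reduces the geometry to linear arithmetic.\<close>

section \<open>Signed distances from the boundary lines and the golden ratio\<close>

declare add_2_eq_Suc [simp del] add_2_eq_Suc' [simp del]

text \<open>Signed distance from the line through the origin along \<open>boundary_dir k\<close>,
  positive to its left. The index is any natural number, with period 5.\<close>

definition side :: "nat \<Rightarrow> complex \<Rightarrow> real" where
  "side k z = Im (z * cnj (boundary_dir k))"

text \<open>By \<open>height_eq\<close> a positive multiple of the coordinate along the bisector of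
  cone \<open>i\<close>, in a form linear in the sides.\<close>

definition height :: "nat \<Rightarrow> complex \<Rightarrow> real" where
  "height i z = side (i + 3) z - side (i + 2) z"

definition gold :: real where
  "gold = 2 * cos \<theta>"

lemma sin_theta_pos: "sin \<theta> > 0"
  unfolding \<theta>_def by (rule sin_gt_zero) auto

lemma sin_2theta_pos: "sin (2 * \<theta>) > 0"
  unfolding \<theta>_def by (rule sin_gt_zero) auto

text \<open>Since 5 \<theta> = 2 pi, sin (3 \<theta>) = - sin (2 \<theta>); expanding both and
  dividing by sin \<theta> leaves a quadratic equation for cos \<theta>.\<close>

lemma gold_square: "gold * gold = 1 - gold"
proof -
  have "sin (3 * \<theta>) = sin (2 * pi - 2 * \<theta>)"
    by (simp add: \<theta>_def)
  also have "\<dots> = - sin (2 * \<theta>)"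
    by (simp add: sin_diff)
  finally have "sin (2 * \<theta> + \<theta>) = - sin (2 * \<theta>)"
    by (simp add: algebra_simps)
  then have "sin \<theta> * (2 * cos \<theta> * cos \<theta> + cos (2 * \<theta>)) = sin \<theta> * (- 2 * cos \<theta>)"
    unfolding sin_add sin_double by (simp add: algebra_simps)
  then have "2 * cos \<theta> * cos \<theta> + cos (2 * \<theta>) = - 2 * cos \<theta>"
    using sin_theta_pos by (metis mult_cancel_left less_irrefl)
  then show ?thesis
    unfolding cos_double_cos by (simp add: gold_def power2_eq_square algebra_simps)
qed

lemma gold_pos: "gold > 0"
  unfolding gold_def \<theta>_def by (simp add: cos_gt_zero)

lemma gold_gt: "gold > 618 / 1000"
proof (rule ccontr)
  assume "\<not> ?thesis"
  then have *: "gold \<le> 618 / 1000"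
    by simp
  have "gold * gold \<le> 618 / 1000 * (618 / 1000)"
    using * gold_pos by (intro mult_mono) auto
  then show False
    using gold_square * by simp
qed

lemma gold_lt: "gold < 619 / 1000"
proof (rule ccontr)
  assume "\<not> ?thesis"
  then have *: "619 / 1000 \<le> gold"
    by simp
  have "619 / 1000 * (619 / 1000) \<le> gold * gold"
    using * by (intro mult_mono) auto
  then show False
    using gold_square * by simp
qed

lemma boundary_dir_eq: "boundary_dir k = - \<i> * cis (- \<theta>) ^ k"
  by (simp add: boundary_dir_def Complex.DeMoivre)

lemma cnj_boundary_dir: "cnj (boundary_dir k) = \<i> * cis \<theta> ^ k"
  by (simp add: boundary_dir_eq cis_cnj)

lemma side_eq: "side k z = Re (z * cis (real k * \<theta>))"
  by (simp add: side_def cnj_boundary_dir Complex.DeMoivre)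

lemma side_linear [simp]:
  "side k (x + y) = side k x + side k y"
  "side k (x - y) = side k x - side k y"
  "side k (c *\<^sub>R x) = c * side k x"
  "side k 0 = 0"
  by (simp_all add: side_def algebra_simps)

lemma height_linear [simp]:
  "height k (x + y) = height k x + height k y"
  "height k (x - y) = height k x - height k y"
  "height k 0 = 0"
  by (simp_all add: height_def)

lemma cis_theta_5: "cis \<theta> ^ 5 = 1"
proof -
  have "cis \<theta> ^ 5 = cis (2 * pi)"
    unfolding Complex.DeMoivre by (simp add: \<theta>_def)
  then show ?thesis
    by simp
qed

lemma side_add5: "side (k + 5) z = side k z"
  by (simp add: side_def cnj_boundary_dir power_add cis_theta_5)

lemma side_add_mult5: "side (k + 5 * m) z = side k z"
proof (induction m)
  case (Suc m)
  then show ?case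
    using side_add5[of "k + 5 * m" z] by (simp add: algebra_simps)
qed simp

lemma side_mod5: "side (k mod 5 + m) z = side (k + m) z"
  using side_add_mult5[of "k mod 5 + m" "k div 5" z]
  by (metis add.assoc add.commute mod_mult_div_eq)

lemma height_mod5: "height (k mod 5) z = height k z"
  unfolding height_def side_mod5 ..

text \<open>The rotations by \<theta> and - \<theta> add up to multiplication by 2 cos \<theta>.
  Hence two consecutive sides determine all five.\<close>

lemma side_rec: "side (k + 2) z = gold * side (k + 1) z - side k z"
proof -
  have "cis (real (k + 2) * \<theta>) + cis (real k * \<theta>) = of_real gold * cis (real (k + 1) * \<theta>)"
  proof -
    have "cis (real (k + 2) * \<theta>) = cis (real (k + 1) * \<theta>) * cis \<theta>"
      "cis (real k * \<theta>) = cis (real (k + 1) * \<theta>) * cis (- \<theta>)"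
      by (simp_all add: cis_mult algebra_simps)
    moreover have "cis \<theta> + cis (- \<theta>) = of_real gold"
      by (simp add: complex_eq_iff gold_def)
    ultimately show ?thesis
      by (metis distrib_left mult.commute)
  qed
  then have "Re (z * (cis (real (k + 2) * \<theta>) + cis (real k * \<theta>)))
      = Re (of_real gold * (z * cis (real (k + 1) * \<theta>)))"
    by (metis mult.left_commute)
  then show ?thesis
    by (simp add: side_eq distrib_left del: of_nat_add of_nat_Suc)
qed

lemma side_rotate: "side (k + m) (cis (- \<theta>) ^ m * z) = side k z"
proof -
  have "cis (- \<theta>) ^ m * cis \<theta> ^ m = 1"
    by (simp add: cis_mult flip: power_mult_distrib)
  then have "cis (- \<theta>) ^ m * z * cnj (boundary_dir (k + m)) = z * cnj (boundary_dir k)"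
    by (simp add: cnj_boundary_dir power_add power2_eq_square algebra_simps)
  then show ?thesis
    unfolding side_def by (rule arg_cong)
qed

text \<open>Clockwise rotation by \<open>m\<close> steps lowers the index by \<open>m\<close>;
  modulo 5 this is adding \<open>4 * m\<close>, which avoids subtraction on naturals.\<close>

lemma side_rotate': "side k (cis (- \<theta>) ^ m * z) = side (k + 4 * m) z"
  using side_rotate[of "k + 4 * m" m z] side_add_mult5[of k m] by (simp add: algebra_simps)

text \<open>Cramer's rule for the basis of two neighbouring boundary directions; sin \<theta> comes
  from their determinant.\<close>

lemma boundary_expansion:
  "sin \<theta> *\<^sub>R z = side (Suc k) z *\<^sub>R boundary_dir k - side k z *\<^sub>R boundary_dir (Suc k)"
proof -
  define \<zeta> where "\<zeta> = z * cnj (boundary_dir k)"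
  have bb: "boundary_dir k * cnj (boundary_dir k) = 1"
    unfolding complex_norm_square[symmetric] by (simp add: boundary_dir_def norm_mult)
  have z: "z = boundary_dir k * \<zeta>"
    using bb by (simp add: \<zeta>_def algebra_simps)
  have s: "side k z = Im \<zeta>"
    by (simp add: side_def \<zeta>_def)
  have "z * cnj (boundary_dir (Suc k)) = \<zeta> * cis \<theta>"
    by (simp add: cnj_boundary_dir \<zeta>_def algebra_simps)
  then have s': "side (Suc k) z = Im (\<zeta> * cis \<theta>)"
    by (simp add: side_def)
  have b': "boundary_dir (Suc k) = boundary_dir k * cis (- \<theta>)"
    by (simp add: boundary_dir_eq)
  have "sin \<theta> *\<^sub>R \<zeta> = of_real (Im (\<zeta> * cis \<theta>)) - of_real (Im \<zeta>) * cis (- \<theta>)"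
    by (simp add: complex_eq_iff algebra_simps)
  then have "boundary_dir k * (sin \<theta> *\<^sub>R \<zeta>)
      = boundary_dir k * (of_real (Im (\<zeta> * cis \<theta>)) - of_real (Im \<zeta>) * cis (- \<theta>))"
    by simp
  then show ?thesis
    unfolding s s' b' by (subst z) (simp add: scaleR_conv_of_real algebra_simps)
qed

lemma side_boundary_dir:
  "side k (boundary_dir k) = 0"
  "side k (boundary_dir (Suc k)) = - sin \<theta>"
  "side (Suc k) (boundary_dir k) = sin \<theta>"
  by (simp_all add: side_eq boundary_dir_def cis_mult algebra_simps cis.simps)

section \<open>Cones, routing and general position as linear conditions\<close>

text \<open>By \<open>boundary_expansion\<close> the two coordinates of \<open>z - u\<close> along
  the cone's boundary rays have the signs of these side differences.\<close>

lemma mem_theta_cone_iff: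
  "z \<in> theta_cone u i \<longleftrightarrow> side (i + 2) z \<le> side (i + 2) u \<and> side (i + 3) u \<le> side (i + 3) z"
proof
  assume "z \<in> theta_cone u i"
  then obtain a b where ab: "0 \<le> a" "0 \<le> b"
    and z: "z = u + a *\<^sub>R boundary_dir (i + 2) + b *\<^sub>R boundary_dir (i + 3)"
    by (auto simp: theta_cone_def)
  show "side (i + 2) z \<le> side (i + 2) u \<and> side (i + 3) u \<le> side (i + 3) z"
    using ab sin_theta_pos side_boundary_dir[of "i + 2"] side_boundary_dir(1)[of "i + 3"]
    by (simp add: z eval_nat_numeral)
next
  assume *: "side (i + 2) z \<le> side (i + 2) u \<and> side (i + 3) u \<le> side (i + 3) z"
  define a where "a = side (i + 3) (z - u) / sin \<theta>"
  define b where "b = - side (i + 2) (z - u) / sin \<theta>"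
  have "0 \<le> a" "0 \<le> b"
    using * sin_theta_pos by (simp_all add: a_def b_def divide_nonpos_pos)
  moreover have "z - u = (1 / sin \<theta>) *\<^sub>R (sin \<theta> *\<^sub>R (z - u))"
    using sin_theta_pos by simp
  then have "z - u = a *\<^sub>R boundary_dir (i + 2) + b *\<^sub>R boundary_dir (i + 3)"
    unfolding boundary_expansion[of "z - u" "i + 2"]
    by (simp add: a_def b_def scaleR_diff_right eval_nat_numeral diff_divide_distrib minus_divide_left algebra_simps)
  then have "z = u + a *\<^sub>R boundary_dir (i + 2) + b *\<^sub>R boundary_dir (i + 3)"
    by (simp add: algebra_simps)
  ultimately show "z \<in> theta_cone u i"
    unfolding theta_cone_def by blast
qed

lemma bisector_dir_eq: "bisector_dir i = - boundary_dir i"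
  by (simp add: bisector_dir_def boundary_dir_def)

text \<open>As 5 \<theta> = 2 pi, \<open>cis \<theta> ^ 3\<close> and
  \<open>cis \<theta> ^ 2\<close> are conjugate; their difference is imaginary, so only the
  component along the bisector survives.\<close>

lemma height_eq: "height i z = 2 * sin (2 * \<theta>) * (z \<bullet> bisector_dir i)"
proof -
  have "cis \<theta> ^ 3 = cnj (cis \<theta> ^ 2)"
  proof -
    have "cis \<theta> ^ 3 = cis \<theta> ^ 5 * cis (- \<theta>) ^ 2"
      unfolding Complex.DeMoivre cis_mult by simp
    then show ?thesis
      by (simp add: cis_theta_5 cis_cnj)
  qed
  then have "cis \<theta> ^ 3 - cis \<theta> ^ 2 = - 2 * \<i> * sin (2 * \<theta>)"
    by (simp add: Complex.DeMoivre complex_eq_iff)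
  moreover have "z * cnj (boundary_dir (i + 3)) - z * cnj (boundary_dir (i + 2))
      = z * cnj (boundary_dir i) * (cis \<theta> ^ 3 - cis \<theta> ^ 2)"
    by (simp add: cnj_boundary_dir power_add power2_eq_square algebra_simps)
  then have "height i z = Im (z * cnj (boundary_dir i) * (cis \<theta> ^ 3 - cis \<theta> ^ 2))"
    unfolding height_def side_def minus_complex.sel(2)[symmetric] by (rule arg_cong)
  ultimately have "height i z = Im (z * cnj (boundary_dir i) * (- 2 * \<i> * sin (2 * \<theta>)))"
    by simp
  then show ?thesis
    by (simp add: bisector_dir_eq inner_complex_def algebra_simps)
qed

lemma dist_bisector_proj: "dist u (bisector_proj u i x) = \<bar>height i (x - u)\<bar> / (2 * sin (2 * \<theta>))"
proof -
  have "norm (bisector_dir i) = 1"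
    by (simp add: bisector_dir_def norm_mult)
  then have "dist u (bisector_proj u i x) = \<bar>(x - u) \<bullet> bisector_dir i\<bar>"
    by (simp add: bisector_proj_def dist_norm)
  then show ?thesis
    using sin_2theta_pos unfolding height_eq by (simp add: abs_mult)
qed

text \<open>For \<open>w - v\<close> the recurrence gives the signs -, +, +, -, - at
  \<open>i + 2\<close>, \<open>i + 3\<close>, \<open>i + 4\<close>, \<open>i + 6\<close>,
  \<open>i + 7\<close>, which rules out each of the other four cones. Strictness matters: the cones
  are closed and share boundary rays.\<close>

lemma theta_cone_unique:
  assumes "side (i + 2) w < side (i + 2) v" "side (i + 3) v < side (i + 3) w"
    and "w \<in> theta_cone v j" "i < 5" "j < 5"
  shows "j = i"
proof -
  define z where "z = w - v"
  have neg: "side (i + 2) z < 0" and pos: "side (i + 3) z > 0"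
    using assms by (simp_all add: z_def)
  have "side (j + 2) z \<le> 0" "side (j + 3) z \<ge> 0"
    using assms(3) by (simp_all add: z_def mem_theta_cone_iff)
  then have j: "side (m + 2) z \<le> 0 \<and> side (m + 3) z \<ge> 0" if "m mod 5 = j mod 5" for m
    using side_mod5[of m 2 z] side_mod5[of m 3 z] side_mod5[of j 2 z] side_mod5[of j 3 z] that
    by simp
  have 4: "side (i + 4) z > 0"
    using side_rec[of "i + 2" z] neg mult_pos_pos[OF gold_pos pos] by (simp add: eval_nat_numeral)
  have 6: "side (i + 6) z < 0"
    using side_rec[of "i + 1" z] pos mult_pos_neg[OF gold_pos neg] side_add5[of "i + 1" z]
    by (simp add: eval_nat_numeral)
  have 7: "side (i + 7) z < 0"
    using neg side_add5[of "i + 2" z] by (simp add: algebra_simps eval_nat_numeral)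
  have ne: "(i + d) mod 5 \<noteq> j mod 5" if "0 < side (i + (d + 2)) z \<or> side (i + (d + 3)) z < 0" for d
    using j[of "i + d"] that by (auto simp: add.assoc)
  have "(i + 1) mod 5 \<noteq> j mod 5" "(i + 2) mod 5 \<noteq> j mod 5"
    "(i + 3) mod 5 \<noteq> j mod 5" "(i + 4) mod 5 \<noteq> j mod 5"
    by (rule ne, use pos 4 6 7 in \<open>simp add: eval_nat_numeral\<close>)+
  moreover have "i \<in> {0, 1, 2, 3, 4}" "j \<in> {0, 1, 2, 3, 4}"
    using assms(4,5) by auto
  ultimately show ?thesis
    by auto
qed

text \<open>Turns a routing step into linear inequalities: every competitor is outside the cone or
  farther up. The cone index is not reduced modulo 5, so that it can follow the number of the corner
  visit.\<close>

lemma theta_routing_eqI: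
  assumes w: "side (i + 2) w < side (i + 2) v" "side (i + 3) v < side (i + 3) w"
    and t: "t \<in> P" "t \<noteq> v" "side (i + 2) t \<le> side (i + 2) v" "side (i + 3) v \<le> side (i + 3) t"
    and others: "\<And>x. x \<in> P \<Longrightarrow> x \<noteq> v \<Longrightarrow> x \<noteq> t \<Longrightarrow>
      side (i + 2) v < side (i + 2) x \<or> side (i + 3) x < side (i + 3) v \<or> height i t < height i x"
  shows "theta_routing P w v = t"
proof -
  define j where "j = i mod 5"
  have j: "j < 5"
    by (simp add: j_def)
  have s: "side (j + m) x = side (i + m) x" for m x
    by (simp add: j_def side_mod5)
  have h: "height j x = height i x" for x
    by (simp add: j_def height_mod5)
  have w': "w \<in> theta_cone v j"
    using w unfolding mem_theta_cone_iff s by simp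
  have height_nonneg: "height i (x - v) \<ge> 0" if "x \<in> theta_cone v j" for x
    using that unfolding mem_theta_cone_iff s by (simp add: height_def)
  have closer: "dist v (bisector_proj v j x) \<le> dist v (bisector_proj v j y)
      \<longleftrightarrow> height i x \<le> height i y"
    if "x \<in> theta_cone v j" "y \<in> theta_cone v j" for x y
    using height_nonneg[OF that(1)] height_nonneg[OF that(2)] sin_2theta_pos
    by (simp add: dist_bisector_proj h divide_le_cancel)
  have t': "t \<in> theta_cone v j"
    using t unfolding mem_theta_cone_iff s by simp
  have best: "height i t < height i x" if "x \<in> P" "x \<noteq> v" "x \<noteq> t" "x \<in> theta_cone v j" for x
    using others[OF that(1-3)] that(4) unfolding mem_theta_cone_iff s by auto
  have "closest_in_cone P v j t"
    unfolding closest_in_cone_def using t t' best by (force simp: closer)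
  moreover have "x = t" if "k < 5" "w \<in> theta_cone v k" "closest_in_cone P v k x" for k x
  proof (rule ccontr)
    assume "x \<noteq> t"
    have "k = j"
      using theta_cone_unique[of j w v k] w that j unfolding s by simp
    then have x: "x \<in> P" "x \<noteq> v" "x \<in> theta_cone v j"
      and "dist v (bisector_proj v j x) \<le> dist v (bisector_proj v j t)"
      using that(3) t t' by (auto simp: closest_in_cone_def)
    then show False
      using best[OF x(1,2) \<open>x \<noteq> t\<close> x(3)] closer[OF x(3) t'] by simp
  qed
  ultimately show ?thesis
    unfolding theta_routing_def using j w' by (intro the_equality) blast+
qed

text \<open>A difference parallel to a boundary has side 0, one perpendicular to it has height
  0.\<close>

lemma general_positionI:
  assumes "\<And>p q k. p \<in> P \<Longrightarrow> q \<in> P \<Longrightarrow> p \<noteq> q \<Longrightarrow> k < 5 \<Longrightarrow> side k p \<noteq> side k q \<and> height k p \<noteq> height k q"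
  shows "general_position P"
  unfolding general_position_def
proof (intro ballI impI allI)
  fix p q :: complex and k :: nat
  assume pq: "p \<in> P" "q \<in> P" "p \<noteq> q" "k < 5"
  have "q - p \<notin> span {boundary_dir k}"
  proof
    assume "q - p \<in> span {boundary_dir k}"
    then obtain c where "q - p = c *\<^sub>R boundary_dir k"
      by (auto simp: span_singleton)
    then have "side k (q - p) = 0"
      by (simp add: side_boundary_dir del: side_linear(2))
    then show False
      using assms[OF pq] by simp
  qed
  moreover have "\<not> orthogonal (q - p) (boundary_dir k)"
  proof
    assume "orthogonal (q - p) (boundary_dir k)"
    then have "height k (q - p) = 0"
      by (simp add: height_eq bisector_dir_eq orthogonal_def del: height_linear(2))
    then show False
      using assms[OF pq] by simp
  qed
  ultimately show "q - p \<notin> span {boundary_dir k} \<and> \<not> orthogonal (q - p) (boundary_dir k)" ..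
qed

section \<open>Points near the pentagon corners\<close>

definition scale :: "nat \<Rightarrow> real" where
  "scale k = (1 / 100) ^ Suc k"

text \<open>Named so that linear arithmetic treats the product as an atom.\<close>

definition gold_scale :: "nat \<Rightarrow> real" where
  "gold_scale k = gold * scale k"

text \<open>Deviations from the pentagon corner, for arrival points (\<open>e\<close>) and departure points (\<open>\<not> e\<close>), in
  units of \<open>scale k\<close>: \<open>level\<close> is the excess of the distance of the far cone boundary from the origin;
  \<open>tilt\<close> is positive iff the rotated point lies before the base of its predecessor's triangle. Many
  values work; these also keep the 20 coefficients in \<open>side_site_inj\<close> and \<open>height_site_inj\<close> apart.\<close>

definition level :: "bool \<Rightarrow> real" where
  "level e = (if e then 6 else 5)"

definition tilt :: "bool \<Rightarrow> real" where
  "tilt e = (if e then 6 else - 6)"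

text \<open>\<open>boundary_expansion\<close> solved for the point with prescribed
  \<open>side 1\<close> and \<open>side 2\<close>. Without the deviations both are 1, which is the
  exact corner, with the origin in its top cone.\<close>

definition site :: "bool \<Rightarrow> nat \<Rightarrow> complex" where
  "site e k = (1 / sin \<theta>) *\<^sub>R
     ((1 + level e * scale k) *\<^sub>R boundary_dir 1 - (1 + (level e + tilt e) * scale k) *\<^sub>R boundary_dir 2)"

text \<open>Visit \<open>k\<close> takes place at the corner rotated \<open>k\<close> times, so
  visits five apart share a corner.\<close>

definition spiral_point :: "bool \<Rightarrow> nat \<Rightarrow> complex" where
  "spiral_point e k = cis (- \<theta>) ^ k * site e k"

lemma scale_pos: "0 < scale k"
  by (simp add: scale_def)

lemma scale_le: "scale k \<le> 1 / 100"
  using power_le_one[of "1 / 100 :: real" k] by (simp add: scale_def)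

lemma scale_less: "j < k \<Longrightarrow> 100 * scale k \<le> scale j"
proof -
  assume "j < k"
  then have "(1 / 100 :: real) ^ Suc (Suc k) \<le> (1 / 100) ^ Suc (Suc (Suc j))"
    by (intro power_decreasing) auto
  then show ?thesis
    by (simp add: scale_def)
qed

lemma side_1_site: "side 1 (site e k) = 1 + (level e + tilt e) * scale k"
  using sin_theta_pos side_boundary_dir[of 1] by (simp add: site_def eval_nat_numeral)

lemma side_2_site: "side 2 (site e k) = 1 + level e * scale k"
  using sin_theta_pos side_boundary_dir[of 1] side_boundary_dir(1)[of 2]
  by (simp add: site_def eval_nat_numeral)

lemma gold_gold: "gold * (gold * x) = x - gold * x"
  by (metis gold_square left_diff_distrib mult.assoc mult_1)

lemma side_3_site: "side 3 (site e k) = gold - 1 + level e * (gold_scale k - scale k) - tilt e * scale k"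
  using side_rec[of 1 "site e k"] side_1_site[of e k] side_2_site[of e k]
  by (simp add: gold_scale_def algebra_simps eval_nat_numeral)

lemma side_0_site: "side 0 (site e k) = gold - 1 + level e * (gold_scale k - scale k) + tilt e * gold_scale k"
  using side_rec[of 0 "site e k"] side_1_site[of e k] side_2_site[of e k]
  by (simp add: gold_scale_def algebra_simps eval_nat_numeral)

lemma side_4_site: "side 4 (site e k) = - 2 * gold - (2 * level e + tilt e) * gold_scale k"
proof -
  have "side 4 (site e k) = gold * side 3 (site e k) - side 2 (site e k)"
    using side_rec[of 2 "site e k"] by (simp add: eval_nat_numeral)
  then show ?thesis
    by (simp add: side_2_site side_3_site gold_scale_def algebra_simps gold_gold gold_square)
qed

lemmas side_site = side_0_site side_1_site side_2_site side_3_site side_4_site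

text \<open>Index 4 is the view from the preceding corner. There the constant term vanishes: the
  exact corner is level with the origin, and \<open>tilt\<close> breaks the tie.\<close>

lemma height_site:
  "height 0 (site e k) = gold - 2 + level e * (gold_scale k - 2 * scale k) - tilt e * scale k"
  "height 1 (site e k) = 1 - 3 * gold + level e * (scale k - 3 * gold_scale k) + tilt e * (scale k - gold_scale k)"
  "height 2 (site e k) = 3 * gold - 1 + level e * (3 * gold_scale k - scale k) + 2 * tilt e * gold_scale k"
  "height 3 (site e k) = 2 - gold + level e * (2 * scale k - gold_scale k) + tilt e * (scale k - gold_scale k)"
  "height 4 (site e k) = - tilt e * scale k"
  using side_add5[of 0 "site e k"] side_add5[of 1 "site e k"] side_add5[of 2 "site e k"]
  by (simp_all add: height_def side_site side_site[unfolded One_nat_def] algebra_simps)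

section \<open>General position of the rotated points\<close>

lemma side_spiral_point: "side (k + n) (spiral_point e j) = side ((k + 4 * j) mod 5 + n) (site e j)"
  unfolding spiral_point_def side_rotate' side_mod5 by (simp add: algebra_simps)

lemma height_spiral_point: "height k (spiral_point e j) = height ((k + 4 * j) mod 5) (site e j)"
  by (simp add: height_def side_spiral_point)

text \<open>The ratio of two admissible coefficients is below 100, the ratio of consecutive scales.\<close>

lemma scale_mult_eq:
  assumes "a * scale j = b * scale k" "1 / 5 \<le> \<bar>a\<bar>" "\<bar>a\<bar> \<le> 15" "1 / 5 \<le> \<bar>b\<bar>" "\<bar>b\<bar> \<le> 15"
  shows "j = k \<and> a = b"
proof -
  have abs: "\<bar>a\<bar> * scale j = \<bar>b\<bar> * scale k"
    using assms(1) scale_pos by (metis abs_mult abs_of_pos)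
  have no: False if "m < n" "x * scale m = y * scale n" "1 / 5 \<le> x" "y \<le> 15" for m n and x y :: real
  proof -
    have "y * scale n \<le> 15 * scale n" "1 / 5 * scale m \<le> x * scale m"
      using that scale_pos[of n] scale_pos[of m] by (intro mult_right_mono; simp)+
    then show False
      using that(2) scale_less[OF that(1)] scale_pos[of n] by linarith
  qed
  have "j = k"
    using no[of j k "\<bar>a\<bar>" "\<bar>b\<bar>"] no[of k j "\<bar>b\<bar>" "\<bar>a\<bar>"] abs assms by (metis linorder_neqE_nat)
  then show ?thesis
    using assms(1) scale_pos[of k] by simp
qed

text \<open>Each deviation is at most 15/100, so it cannot bridge constants more than 3/10 apart;
  for equal constants \<open>scale_mult_eq\<close> compares the deviations.\<close>

lemma affine_inj:
  fixes S :: "nat \<Rightarrow> real" and c :: "nat \<Rightarrow> bool \<Rightarrow> real"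
  assumes base: "\<And>p q. p < 5 \<Longrightarrow> q < 5 \<Longrightarrow> S p = S q \<or> 3 / 10 < \<bar>S p - S q\<bar>"
    and coef: "\<And>p e. p < 5 \<Longrightarrow> 1 / 5 \<le> \<bar>c p e\<bar> \<and> \<bar>c p e\<bar> \<le> 15"
    and inj: "\<And>p q e e'. p < 5 \<Longrightarrow> q < 5 \<Longrightarrow> S p = S q \<Longrightarrow> c p e = c q e' \<Longrightarrow> p = q \<and> e = e'"
    and pq: "p < 5" "q < 5" and eq: "S p + c p e * scale j = S q + c q e' * scale k"
  shows "p = q \<and> e = e' \<and> j = k"
proof -
  have "\<bar>c p e * scale j\<bar> \<le> 15 * (1 / 100)" "\<bar>c q e' * scale k\<bar> \<le> 15 * (1 / 100)"
    unfolding abs_mult using coef pq scale_le scale_pos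
    by (intro mult_mono; simp add: less_imp_le)+
  then have S: "S p = S q"
    using base[OF pq] eq by linarith
  then have "j = k \<and> c p e = c q e'"
    using eq coef pq by (intro scale_mult_eq) auto
  then show ?thesis
    using inj[OF pq S] by blast
qed

lemma less_5_cases: "p < 5 \<longleftrightarrow> p = 0 \<or> p = 1 \<or> p = 2 \<or> p = 3 \<or> p = (4::nat)"
  by auto

text \<open>Rotation only shifts the index, so comparing all indices settles all pairs of rotated
  points. The exact corner is symmetric and its sides coincide in two pairs; there the coefficients
  must tell the indices apart.\<close>

lemma side_site_inj:
  assumes "p < 5" "q < 5" "side p (site e j) = side q (site e' k)"
  shows "p = q \<and> e = e' \<and> j = k"
proof -
  define S where "S p = [gold - 1, 1, 1, gold - 1, - 2 * gold] ! p" for p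
  define c where "c p e = [(gold - 1) * level e + gold * tilt e, level e + tilt e, level e,
    (gold - 1) * level e - tilt e, - gold * (2 * level e + tilt e)] ! p" for p e
  have *: "side p (site e k) = S p + c p e * scale k" if "p < 5" for p e k
    using that unfolding less_5_cases by (elim disjE) (simp_all add: S_def c_def side_site[simplified] gold_scale_def algebra_simps)
  show ?thesis
  proof (rule affine_inj[of S c])
    show "S p = S q \<or> 3 / 10 < \<bar>S p - S q\<bar>" if "p < 5" "q < 5" for p q
      using that gold_gt gold_lt unfolding less_5_cases by (elim disjE) (simp_all add: S_def)
    show "1 / 5 \<le> \<bar>c p e\<bar> \<and> \<bar>c p e\<bar> \<le> 15" if "p < 5" for p e
      using that gold_gt gold_lt unfolding less_5_cases
      by (elim disjE; cases e) (simp_all add: c_def level_def tilt_def)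
    show "p = q \<and> e = e'" if "p < 5" "q < 5" "S p = S q" "c p e = c q e'" for p q e e'
      using that gold_gt gold_lt unfolding less_5_cases
      by (elim disjE; cases e; cases e') (simp_all add: S_def c_def level_def tilt_def)
  qed (use assms * in simp_all)
qed

text \<open>Here the five constants differ, so the coefficients only have to separate arrival from
  departure points.\<close>

lemma height_site_inj:
  assumes "p < 5" "q < 5" "height p (site e j) = height q (site e' k)"
  shows "p = q \<and> e = e' \<and> j = k"
proof -
  define S where "S p = [gold - 2, 1 - 3 * gold, 3 * gold - 1, 2 - gold, 0] ! p" for p
  define c where "c p e = [(gold - 2) * level e - tilt e, (1 - 3 * gold) * level e + (1 - gold) * tilt e,
    (3 * gold - 1) * level e + 2 * gold * tilt e, (2 - gold) * level e + (1 - gold) * tilt e, - tilt e] ! p" for p e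
  have *: "height p (site e k) = S p + c p e * scale k" if "p < 5" for p e k
    using that unfolding less_5_cases by (elim disjE) (simp_all add: S_def c_def height_site[simplified] gold_scale_def algebra_simps)
  show ?thesis
  proof (rule affine_inj[of S c])
    show "S p = S q \<or> 3 / 10 < \<bar>S p - S q\<bar>" if "p < 5" "q < 5" for p q
      using that gold_gt gold_lt unfolding less_5_cases by (elim disjE) (simp_all add: S_def)
    show "1 / 5 \<le> \<bar>c p e\<bar> \<and> \<bar>c p e\<bar> \<le> 15" if "p < 5" for p e
      using that gold_gt gold_lt unfolding less_5_cases
      by (elim disjE; cases e) (simp_all add: c_def level_def tilt_def)
    show "p = q \<and> e = e'" if "p < 5" "q < 5" "S p = S q" "c p e = c q e'" for p q e e'
      using that gold_gt gold_lt unfolding less_5_cases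
      by (elim disjE; cases e; cases e') (simp_all add: S_def c_def level_def tilt_def)
  qed (use assms * in simp_all)
qed

lemma gold_scale_gt: "618 / 1000 * scale k < gold_scale k"
  unfolding gold_scale_def using gold_gt scale_pos by (rule mult_strict_right_mono)

lemma gold_scale_lt: "gold_scale k < 619 / 1000 * scale k"
  unfolding gold_scale_def using gold_lt scale_pos by (rule mult_strict_right_mono)

text \<open>Seen from corner \<open>k\<close>, its own points have index 0 and those of the next
  corner index 4.\<close>

lemma mod_next: "(k + 4 * Suc k) mod 5 = 4" "(k + 4 * k) mod 5 = 0"
  by presburger+

lemma spiral_point_side_inj: "side m (spiral_point e j) = side m (spiral_point e' k) \<Longrightarrow> e = e' \<and> j = k"
  using side_site_inj[of "(m + 4 * j) mod 5" "(m + 4 * k) mod 5" e j e' k]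
    side_spiral_point[of m 0 e j] side_spiral_point[of m 0 e' k] by simp

lemma spiral_point_height_inj: "height m (spiral_point e j) = height m (spiral_point e' k) \<Longrightarrow> e = e' \<and> j = k"
  using height_site_inj[of "(m + 4 * j) mod 5" "(m + 4 * k) mod 5" e j e' k]
  by (simp add: height_spiral_point)

text \<open>The origin belongs to the point set too, so general position also asks for this.\<close>

lemma site_nonzero:
  assumes "p < 5"
  shows "side p (site e k) \<noteq> 0" "height p (site e k) \<noteq> 0"
proof -
  show "side p (site e k) \<noteq> 0"
    using assms gold_gt gold_lt gold_scale_gt[of k] gold_scale_lt[of k] scale_pos[of k] scale_le[of k] unfolding less_5_cases
    by (elim disjE; cases e) (simp_all add: side_site[simplified] level_def tilt_def algebra_simps)
  show "height p (site e k) \<noteq> 0"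
    using assms gold_gt gold_lt gold_scale_gt[of k] gold_scale_lt[of k] scale_pos[of k] scale_le[of k] unfolding less_5_cases
    by (elim disjE; cases e) (simp_all add: height_site[simplified] level_def tilt_def algebra_simps)
qed

lemma spiral_point_nonzero: "side m (spiral_point e k) \<noteq> 0" "height m (spiral_point e k) \<noteq> 0"
  using site_nonzero[of "(m + 4 * k) mod 5" e k] side_spiral_point[of m 0 e k] height_spiral_point[of m e k] by simp_all

section \<open>The two kinds of routing steps\<close>

lemma route_arrival:
  assumes P: "\<And>x. x \<in> P \<Longrightarrow> x = 0 \<or> (\<exists>e j. x = spiral_point e j)" and t: "spiral_point False k \<in> P"
  shows "theta_routing P 0 (spiral_point True k) = spiral_point False k"
proof (rule theta_routing_eqI[where i = k])
  note b = gold_gt gold_lt gold_scale_gt[of k] gold_scale_lt[of k] scale_pos[of k] scale_le[of k]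
  have own: "side (k + n) (spiral_point e k) = side n (site e k)" "height k (spiral_point e k) = height 0 (site e k)" for n e
    by (simp_all add: side_spiral_point height_spiral_point mod_next)
  show "side (k + 2) 0 < side (k + 2) (spiral_point True k)" "side (k + 3) (spiral_point True k) < side (k + 3) 0"
    using b by (simp_all add: own side_site level_def tilt_def algebra_simps)
  show "side (k + 2) (spiral_point False k) \<le> side (k + 2) (spiral_point True k)"
    "side (k + 3) (spiral_point True k) \<le> side (k + 3) (spiral_point False k)"
    using b by (simp_all add: own side_site level_def tilt_def algebra_simps)
  show "spiral_point False k \<noteq> spiral_point True k"
    using spiral_point_side_inj by metis
  show "spiral_point False k \<in> P" by fact
  fix x
  assume x: "x \<in> P" "x \<noteq> spiral_point True k" "x \<noteq> spiral_point False k"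
  show "side (k + 2) (spiral_point True k) < side (k + 2) x \<or> side (k + 3) x < side (k + 3) (spiral_point True k)
    \<or> height k (spiral_point False k) < height k x"
  proof (cases "x = 0")
    case True
    then show ?thesis
      using b by (simp add: own height_site level_def tilt_def algebra_simps)
  next
    case False
    then obtain e j where xe: "x = spiral_point e j"
      using P x by blast
    have jk: "j \<noteq> k"
      using x xe by (cases e) auto
    note b' = b gold_scale_gt[of j] gold_scale_lt[of j] scale_pos[of j] scale_le[of j]
    \<comment> \<open>This is \<open>k - j\<close> modulo 5, the position of the corner of
      \<open>x\<close> relative to corner \<open>k\<close>.\<close>
    define r where "r = (k + 4 * j) mod 5"
    have sx: "side (k + n) x = side (r + n) (site e j)" "height k x = height r (site e j)" for n
      by (simp_all add: xe r_def side_spiral_point height_spiral_point)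
    have "r < 5"
      by (simp add: r_def)
    \<comment> \<open>At the same corner, earlier visitors lie outside the cone and later ones lie
      farther up; all other corners are farther up already by their constant terms.\<close>
    then consider "r = 0" "j < k" | "r = 0" "k < j" | "r = 1" | "r = 2" | "r = 3" | "r = 4"
      using jk by linarith
    then show ?thesis
    proof cases
      case 1
      have "side (k + 2) (spiral_point True k) < side (k + 2) x"
        using b' scale_less[OF 1(2)] unfolding sx own 1(1)
        by (cases e) (simp_all add: side_site level_def)
      then show ?thesis ..
    next
      case 2
      have "height k (spiral_point False k) < height k x"
        using b' scale_less[OF 2(2)] unfolding sx own 2(1)
        by (cases e) (simp_all add: height_site level_def tilt_def algebra_simps)
      then show ?thesis by simp
    next
      case 3
      have "height k (spiral_point False k) < height k x"
        using b' unfolding sx own 3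
        by (cases e) (simp_all add: height_site[simplified] level_def tilt_def algebra_simps)
      then show ?thesis by simp
    next
      case 4
      have "height k (spiral_point False k) < height k x"
        using b' unfolding sx own 4
        by (cases e) (simp_all add: height_site level_def tilt_def algebra_simps)
      then show ?thesis by simp
    next
      case 5
      have "height k (spiral_point False k) < height k x"
        using b' unfolding sx own 5
        by (cases e) (simp_all add: height_site level_def tilt_def algebra_simps)
      then show ?thesis by simp
    next
      case 6
      have "height k (spiral_point False k) < height k x"
        using b' unfolding sx own 6
        by (cases e) (simp_all add: height_site level_def tilt_def algebra_simps)
      then show ?thesis by simp
    qed
  qed
qed

text \<open>The next arrival point lies just before the base through the origin, so it beats the
  origin; the cases show that the earlier and later visitors of both corners do not
  interfere.\<close>

lemma route_departure:
  assumes P: "\<And>x. x \<in> P \<Longrightarrow> x = 0 \<or> (\<exists>e j. x = spiral_point e j)" and t: "spiral_point True (Suc k) \<in> P"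
  shows "theta_routing P 0 (spiral_point False k) = spiral_point True (Suc k)"
proof (rule theta_routing_eqI[where i = k])
  note b = gold_gt gold_lt gold_scale_gt[of k] gold_scale_lt[of k] scale_pos[of k] scale_le[of k] scale_pos[of "Suc k"] scale_less[OF lessI, of k]
  have own: "side (k + n) (spiral_point e k) = side n (site e k)" "height k (spiral_point e k) = height 0 (site e k)" for n e
    by (simp_all add: side_spiral_point height_spiral_point mod_next)
  have side6: "side 6 z = side 1 z" "side 7 z = side 2 z" for z
    using side_add5[of 1 z] side_add5[of 2 z] by simp_all
  have nxt: "side (k + 2) (spiral_point e (Suc k)) = side 1 (site e (Suc k))"
    "side (k + 3) (spiral_point e (Suc k)) = side 2 (site e (Suc k))"
    "height k (spiral_point e (Suc k)) = height 4 (site e (Suc k))" for e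
    unfolding side_spiral_point height_spiral_point mod_next by (simp_all add: side6)
  show "side (k + 2) 0 < side (k + 2) (spiral_point False k)" "side (k + 3) (spiral_point False k) < side (k + 3) 0"
    using b by (simp_all add: own side_site level_def tilt_def algebra_simps)
  show "side (k + 2) (spiral_point True (Suc k)) \<le> side (k + 2) (spiral_point False k)"
    "side (k + 3) (spiral_point False k) \<le> side (k + 3) (spiral_point True (Suc k))"
    using b by (simp_all add: own nxt side_site side_site[simplified] level_def tilt_def algebra_simps)
  show "spiral_point True (Suc k) \<noteq> spiral_point False k"
    using spiral_point_side_inj by metis
  show "spiral_point True (Suc k) \<in> P" by fact
  fix x
  assume x: "x \<in> P" "x \<noteq> spiral_point False k" "x \<noteq> spiral_point True (Suc k)"
  show "side (k + 2) (spiral_point False k) < side (k + 2) x \<or> side (k + 3) x < side (k + 3) (spiral_point False k)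
    \<or> height k (spiral_point True (Suc k)) < height k x"
  proof (cases "x = 0")
    case True
    then show ?thesis
      using b by (simp add: nxt height_site level_def tilt_def algebra_simps)
  next
    case False
    then obtain e j where xe: "x = spiral_point e j"
      using P x by blast
    note b' = b gold_scale_gt[of j] gold_scale_lt[of j] scale_pos[of j] scale_le[of j]
    define r where "r = (k + 4 * j) mod 5"
    have sx: "side (k + n) x = side (r + n) (site e j)" "height k x = height r (site e j)" for n
      by (simp_all add: xe r_def side_spiral_point height_spiral_point)
    have "r < 5"
      by (simp add: r_def)
    moreover have "\<not> (e \<and> j = Suc k)"
      using x xe by auto
    ultimately consider "r = 0" "j < k" | "r = 0" "j = k" | "r = 0" "k < j"
      | "r = 1" | "r = 2" | "r = 3"
      | "r = 4" "e" "j \<le> k" | "r = 4" "e" "Suc k < j" | "r = 4" "\<not> e"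
      unfolding less_5_cases by (metis Suc_lessI linorder_neqE_nat linorder_not_le)
    then show ?thesis
    proof cases
      case 1
      have "side (k + 2) (spiral_point False k) < side (k + 2) x"
        using b' scale_less[OF 1(2)] unfolding sx own 1(1)
        by (cases e) (simp_all add: side_site level_def)
      then show ?thesis ..
    next
      case 2
      have "e"
        using x xe 2 by (cases e) auto
      then have "side (k + 2) (spiral_point False k) < side (k + 2) x"
        using b' unfolding sx own 2 by (simp add: side_site level_def)
      then show ?thesis ..
    next
      case 3
      \<comment> \<open>The slide has raised \<open>side 3\<close> about 4 scales above the corner
        value \<open>gold - 1\<close>; later visitors deviate far less and fall outside the
        cone.\<close>
      have "side (k + 3) x < side (k + 3) (spiral_point False k)"
        using b' scale_less[OF 3(2)] unfolding sx own 3(1)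
        by (cases e) (simp_all add: side_site level_def tilt_def algebra_simps)
      then show ?thesis by simp
    next
      case 4
      have "side (k + 3) x < side (k + 3) (spiral_point False k)"
        using b' unfolding sx own 4
        by (cases e) (simp_all add: side_site level_def tilt_def algebra_simps)
      then show ?thesis by simp
    next
      case 5
      have "height k (spiral_point True (Suc k)) < height k x"
        using b' unfolding sx nxt 5
        by (cases e) (simp_all add: height_site level_def tilt_def algebra_simps)
      then show ?thesis by simp
    next
      case 6
      have "height k (spiral_point True (Suc k)) < height k x"
        using b' unfolding sx nxt 6
        by (cases e) (simp_all add: height_site level_def tilt_def algebra_simps)
      then show ?thesis by simp
    next
      case 7
      have "scale k \<le> scale j"
        using scale_less[of j k] scale_pos[of k] 7(3) by (cases "j = k") auto
      \<comment> \<open>An earlier arrival exceeds 1 by \<open>level + tilt\<close>, that is 12,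
        times a scale no smaller than \<open>scale k\<close>; the departure point exceeds it by only
        5 times \<open>scale k\<close>.\<close>
      then have "side (k + 2) (spiral_point False k) < side (k + 2) x"
        using b' 7(2) unfolding sx own 7(1)
        by (simp add: side6 side_site side_site[simplified] level_def tilt_def)
      then show ?thesis ..
    next
      case 8
      \<comment> \<open>Both points lie before the base, the later arrival by a smaller scale and
        hence farther up.\<close>
      have "height k (spiral_point True (Suc k)) < height k x"
        using b' scale_less[OF 8(3)] 8(2) unfolding sx nxt 8(1)
        by (simp add: height_site tilt_def)
      then show ?thesis by simp
    next
      case 9
      \<comment> \<open>The negative tilt puts departure points beyond the base.\<close>
      have "height k (spiral_point True (Suc k)) < height k x"
        using b' 9(2) unfolding sx nxt 9(1)
        by (simp add: height_site tilt_def)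
      then show ?thesis by simp
    qed
  qed
qed

section \<open>The forced path and its length\<close>

lemma abs_side_diff_le: "\<bar>side k x - side k y\<bar> \<le> dist x y"
proof -
  have "\<bar>side k (x - y)\<bar> \<le> cmod ((x - y) * cis (real k * \<theta>))"
    unfolding side_eq by (rule abs_Re_le_cmod)
  then show ?thesis
    by (simp add: norm_mult dist_norm)
qed

text \<open>\<open>side (k + 3)\<close> jumps from about \<open>gold - 1\<close> to about 1, and
  sides are 1-Lipschitz.\<close>

lemma departure_dist: "1 / 2 \<le> dist (spiral_point False k) (spiral_point True (Suc k))"
proof -
  have "side (k + 3) (spiral_point False k) = side 3 (site False k)"
    "side (k + 3) (spiral_point True (Suc k)) = side 7 (site True (Suc k))"
    unfolding side_spiral_point mod_next by simp_all
  moreover have "side 7 (site True (Suc k)) = side 2 (site True (Suc k))"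
    using side_add5[of 2] by simp
  ultimately have "1 / 2 \<le> \<bar>side (k + 3) (spiral_point False k) - side (k + 3) (spiral_point True (Suc k))\<bar>"
    using gold_lt gold_scale_lt[of k] scale_pos[of k] scale_le[of k] scale_pos[of "Suc k"]
    by (simp add: side_site level_def tilt_def)
  then show ?thesis
    using abs_side_diff_le order_trans by blast
qed

definition spiral :: "nat \<Rightarrow> complex" where
  "spiral i = spiral_point (even i) (i div 2)"

definition spiral_set :: "nat \<Rightarrow> complex set" where
  "spiral_set m = insert 0 (spiral ` {..<2 * m})"

lemma spiral_eq_iff: "spiral i = spiral j \<longleftrightarrow> i = j"
proof
  assume "spiral i = spiral j"
  then have "even i = even j \<and> i div 2 = j div 2"
    unfolding spiral_def by (intro spiral_point_side_inj[where m = 0]) simp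
  then show "i = j"
    by (metis bit_eq_rec)
qed simp

lemma spiral_nonzero: "spiral i \<noteq> 0"
  using spiral_point_nonzero(1) by (metis side_linear(4) spiral_def)

lemma card_spiral_set: "card (spiral_set m) = 2 * m + 1"
proof -
  have "card (spiral ` {..<2 * m}) = 2 * m"
    by (subst card_image) (auto simp: inj_on_def spiral_eq_iff)
  then show ?thesis
    unfolding spiral_set_def using spiral_nonzero by (subst card_insert_disjoint) (auto simp: image_iff)
qed

lemma spiral_set_cases: "x \<in> spiral_set m \<Longrightarrow> x = 0 \<or> (\<exists>e j. x = spiral_point e j)"
  by (auto simp: spiral_set_def spiral_def)

lemma general_position_spiral_set: "general_position (spiral_set m)"
proof (rule general_positionI)
  fix p q :: complex and k :: nat
  assume pq: "p \<in> spiral_set m" "q \<in> spiral_set m" "p \<noteq> q"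
  then show "side k p \<noteq> side k q \<and> height k p \<noteq> height k q"
    using spiral_set_cases[OF pq(1)] spiral_set_cases[OF pq(2)]
    by (elim disjE exE)
      (auto simp: spiral_point_nonzero spiral_point_nonzero[THEN not_sym] dest: spiral_point_side_inj spiral_point_height_inj)
qed

lemma route_spiral:
  assumes "Suc i < 2 * m"
  shows "theta_routing (spiral_set m) 0 (spiral i) = spiral (Suc i)"
proof -
  have mem: "spiral (Suc i) \<in> spiral_set m"
    using assms by (simp add: spiral_set_def)
  show ?thesis
  proof (cases "even i")
    case True
    then show ?thesis
      using route_arrival[of "spiral_set m" "i div 2", OF spiral_set_cases] mem by (simp add: spiral_def)
  next
    case False
    then have "Suc i div 2 = Suc (i div 2)"
      by presburger
    then show ?thesis
      using route_departure[of "spiral_set m" "i div 2", OF spiral_set_cases] mem False by (simp add: spiral_def)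
  qed
qed

text \<open>Routing is deterministic, and a found path ends at the origin, so it cannot stop at a
  spiral point.\<close>

lemma finds_spiral_nth:
  assumes "finds (theta_routing (spiral_set m)) (spiral 0) 0 p" "i < 2 * m"
  shows "i < length p \<and> p ! i = spiral i"
  using assms(2)
proof (induction i)
  case 0
  then show ?case
    using assms(1) by (auto simp: finds_def hd_conv_nth)
next
  case (Suc i)
  then have i: "i < length p" "p ! i = spiral i"
    by auto
  have "Suc i \<noteq> length p"
  proof
    assume "Suc i = length p"
    then have "last p = spiral i"
      using i by (metis diff_Suc_1 last_conv_nth length_0_conv nat.distinct(1))
    then show False
      using assms(1) spiral_nonzero by (auto simp: finds_def)
  qed
  then have "Suc i < length p"
    using i by simp
  then show ?case
    using assms(1) i route_spiral[OF Suc.prems] by (simp add: finds_def)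
qed

lemma finds_spiral_path_len:
  assumes "finds (theta_routing (spiral_set m)) (spiral 0) 0 p" "m > 0"
  shows "real (m - 1) / 2 \<le> path_len p"
proof -
  have nth: "p ! i = spiral i" "i < length p" if "i < 2 * m" for i
    using finds_spiral_nth[OF assms(1) that] by auto
  \<comment> \<open>Only the jumps from a departure to the next arrival are counted;
    \<open>m\<close> visits contain \<open>m - 1\<close> of them.\<close>
  define I where "I = (\<lambda>k. 2 * k + 1) ` {..<m - 1}"
  have "real (m - 1) / 2 = (\<Sum>k<m - 1. 1 / 2)"
    by simp
  also have "\<dots> \<le> (\<Sum>k<m - 1. dist (p ! (2 * k + 1)) (p ! Suc (2 * k + 1)))"
  proof (rule sum_mono)
    fix k assume "k \<in> {..<m - 1}"
    then have "2 * k + 1 < 2 * m" "Suc (2 * k + 1) < 2 * m"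
      by auto
    then show "1 / 2 \<le> dist (p ! (2 * k + 1)) (p ! Suc (2 * k + 1))"
      using departure_dist[of k] by (simp add: nth spiral_def)
  qed
  also have "\<dots> = (\<Sum>i\<in>I. dist (p ! i) (p ! Suc i))"
    unfolding I_def by (subst sum.reindex) (auto simp: inj_on_def)
  also have "\<dots> \<le> path_len p"
    unfolding path_len_def
  proof (rule sum_mono2)
    show "I \<subseteq> {..<length p - 1}"
      using nth(2)[of "2 * m - 1"] assms(2) by (auto simp: I_def)
  qed auto
  finally show ?thesis .
qed

theorem lemma5:
  "\<not> (\<exists>f :: nat \<Rightarrow> real.
        (\<forall>n. 0 < f n) \<and>
        (\<lambda>n. f n / real n) \<longlonglongrightarrow> 0 \<and>
        (\<forall>n\<ge>2. \<forall>P :: complex set.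
           finite P \<and> card P = n \<and> general_position P \<longrightarrow>
           competitive (f n) (theta5_graph P) (theta_routing P)))"
proof
  assume "\<exists>f :: nat \<Rightarrow> real. (\<forall>n. 0 < f n) \<and> (\<lambda>n. f n / real n) \<longlonglongrightarrow> 0 \<and>
    (\<forall>n\<ge>2. \<forall>P :: complex set. finite P \<and> card P = n \<and> general_position P \<longrightarrow>
       competitive (f n) (theta5_graph P) (theta_routing P))"
  then obtain f :: "nat \<Rightarrow> real" where lim: "(\<lambda>n. f n / real n) \<longlonglongrightarrow> 0"
    and f: "\<And>n P. n \<ge> 2 \<Longrightarrow> finite P \<Longrightarrow> card P = n \<Longrightarrow> general_position P \<Longrightarrow>
       competitive (f n) (theta5_graph P) (theta_routing P)"
    by metis
  \<comment> \<open>The source \<open>spiral 0\<close> is the same for every \<open>m\<close>, so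
    this distance is constant.\<close>
  define K where "K = dist (spiral 0) 0"
  have K: "K > 0"
    using spiral_nonzero by (simp add: K_def)
  have "\<forall>\<^sub>F n in sequentially. f n / real n < 1 / (8 * K)"
    using order_tendstoD(2)[OF lim, of "1 / (8 * K)"] K by simp
  then obtain n0 where n0: "\<And>n. n \<ge> n0 \<Longrightarrow> f n / real n < 1 / (8 * K)"
    by (auto simp: eventually_sequentially)
  \<comment> \<open>The path length is at least \<open>(m - 1) / 2 = (n - 3) / 4\<close>, which is
    at least \<open>n / 8\<close> once \<open>n \<ge> 6\<close>; adding 3 gives
    \<open>n \<ge> 7\<close>, and also \<open>n \<ge> n0\<close>.\<close>
  define m where "m = n0 + 3"
  define n where "n = 2 * m + 1"
  have "competitive (f n) (theta5_graph (spiral_set m)) (theta_routing (spiral_set m))"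
    by (intro f) (simp_all add: n_def m_def card_spiral_set general_position_spiral_set, simp add: spiral_set_def)
  moreover have "spiral 0 \<in> fst (theta5_graph (spiral_set m))" "0 \<in> fst (theta5_graph (spiral_set m))"
    by (simp_all add: theta5_graph_def spiral_set_def m_def)
  ultimately obtain p where p: "finds (theta_routing (spiral_set m)) (spiral 0) 0 p"
    "path_len p \<le> f n * K"
    unfolding competitive_def K_def by blast
  have "real (m - 1) / 2 \<le> f n * K"
    using finds_spiral_path_len[OF p(1)] p(2) by (simp add: m_def)
  moreover have "f n * K < real n / 8"
    using n0[of n] K by (simp add: n_def m_def field_simps)
  ultimately show False
    by (simp add: n_def m_def)
qed

end
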